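(* Let $A, B \in \mathbb{C}^{n\times n}$ be non-zero Hermitian positive semi-definite matrices. Then $$\sqrt{\operatorname{sr}(A+B)} \le \sqrt{\operatorname{sr}(A)} + \sqrt{\operatorname{sr}(B)}.$$
   Context: The stable rank of a non-zero matrix $A\in\mathbb{C}^{m\times n}$ is $\operatorname{sr}(A) = \|A\|_F^2/\|A\|_2^2$, where $\|A\|_F$ is the Frobenius norm and $\|A\|_2$ is the operator two-norm (largest singular value). For the zero matrix, $\operatorname{sr}(0)=0$. *)

theory Defs
  imports "HOL-Analysis.Analysis"
begin

definition conj_transpose :: "complex ^ 'n ^ 'm \<Rightarrow> complex ^ 'm ^ 'n" where
  "conj_transpose A = (\<chi> i j. cnj (A $ j $ i))"

definition hermitian :: "complex ^ 'n ^ 'n \<Rightarrow> bool" where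
  "hermitian A \<longleftrightarrow> conj_transpose A = A"

(* The inner product class of the library is real-valued, so the sesquilinear
   form y* x is written out; it is conjugate-linear in the first argument. *)
definition cdot :: "complex ^ 'n \<Rightarrow> complex ^ 'n \<Rightarrow> complex" where
  "cdot y x = (\<Sum>i\<in>UNIV. cnj (y $ i) * x $ i)"

definition hermitian_psd :: "complex ^ 'n ^ 'n \<Rightarrow> bool" where
  "hermitian_psd A \<longleftrightarrow> hermitian A \<and> (\<forall>x. cdot x (A *v x) \<in> \<real>\<^sub>\<ge>\<^sub>0)"

definition frobenius_norm :: "complex ^ 'n ^ 'm \<Rightarrow> real" where
  "frobenius_norm A = sqrt (\<Sum>i\<in>UNIV. \<Sum>j\<in>UNIV. (cmod (A $ i $ j))\<^sup>2)"

(* The norm of the library on complex ^ 'n is the Euclidean one, so this is the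
   operator norm induced by the two-norms, i.e. the largest singular value. *)
definition op_two_norm :: "complex ^ 'n ^ 'm \<Rightarrow> real" where
  "op_two_norm A = onorm (\<lambda>x. A *v x)"

definition stable_rank :: "complex ^ 'n ^ 'm \<Rightarrow> real" where
  "stable_rank A = (if A = 0 then 0 else (frobenius_norm A)\<^sup>2 / (op_two_norm A)\<^sup>2)"

end

(* For a non-zero matrix, sqrt (stable_rank A) is the quotient of the Frobenius and the operator norm.
   The numerator is subadditive, and for positive semi-definite matrices the denominator of A + B
   dominates both those of A and of B. *)
theory Submission
  imports Defs
begin

text \<open>Positivity of \<open>g\<close> bounds the quadratic form of \<open>f\<close> by that of
  \<open>f + g\<close>, hence by \<open>?M * (norm x)\<^sup>2\<close>. Symmetry and positivity make
  \<open>x \<bullet> f y\<close> a semi-inner product, and its Cauchy-Schwarz inequality turns the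
  bound on the form into one on \<open>norm (f x)\<close>.\<close>

lemma onorm_mono_psd:
  fixes f g :: "'a::real_inner \<Rightarrow> 'a"
  assumes "bounded_linear f" and "bounded_linear g"
    and sym: "\<And>x y. x \<bullet> f y = f x \<bullet> y"
    and f_psd: "\<And>x. 0 \<le> x \<bullet> f x" and g_psd: "\<And>x. 0 \<le> x \<bullet> g x"
  shows "onorm f \<le> onorm (\<lambda>x. f x + g x)"
proof (rule onorm_bound)
  interpret f: bounded_linear f by fact
  let ?M = "onorm (\<lambda>x. f x + g x)"
  have bl: "bounded_linear (\<lambda>x. f x + g x)"
    using assms(1,2) by (rule bounded_linear_add)
  show M0: "0 \<le> ?M" by (rule onorm_pos_le[OF bl])
  have bound: "x \<bullet> f x \<le> ?M * (norm x)\<^sup>2" for x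
  proof -
    have "x \<bullet> f x \<le> x \<bullet> (f x + g x)"
      using g_psd by (simp add: inner_add_right)
    also have "\<dots> \<le> norm x * norm (f x + g x)" by (rule norm_cauchy_schwarz)
    also have "\<dots> \<le> norm x * (?M * norm x)"
      by (intro mult_left_mono onorm[OF bl]) simp
    finally show ?thesis by (simp add: power2_eq_square mult_ac)
  qed
  fix x
  let ?b = "(norm (f x))\<^sup>2"
  \<comment> \<open>Cauchy-Schwarz for the form of \<open>f\<close> at \<open>x\<close> and \<open>f x\<close>: positivity at \<open>x + t f x\<close> for the best \<open>t\<close>.\<close>
  have quad: "0 \<le> ?M * (norm x)\<^sup>2 + 2 * t * ?b + t\<^sup>2 * (?M * ?b)" for t
  proof -
    have "0 \<le> (x + t *\<^sub>R f x) \<bullet> f (x + t *\<^sub>R f x)" by (rule f_psd)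
    also have "\<dots> = x \<bullet> f x + 2 * t * ?b + t\<^sup>2 * (f x \<bullet> f (f x))"
      using sym[of x "f x"]
      by (simp add: f.add f.scaleR inner_add_left inner_add_right power2_norm_eq_inner
          power2_eq_square[of t] algebra_simps)
    also have "\<dots> \<le> ?M * (norm x)\<^sup>2 + 2 * t * ?b + t\<^sup>2 * (?M * ?b)"
      by (intro add_mono order_refl bound mult_left_mono[OF bound]) simp
    finally show ?thesis .
  qed
  have "?b \<le> (?M * norm x)\<^sup>2"
  proof (cases "?M = 0")
    case True
    \<comment> \<open>Only the term linear in \<open>t\<close> survives in \<open>quad\<close>, so a
      negative \<open>t\<close> forces \<open>?b\<close> to vanish.\<close>
    then show ?thesis using quad[of "-1"] by simp
  next
    case False
    then have "0 < ?M" using M0 by simp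
    \<comment> \<open>The quadratic in \<open>t\<close> from \<open>quad\<close> is smallest at
      \<open>t = - 1 / ?M\<close>; the extra factor \<open>?M\<close> clears the
      denominator.\<close>
    have "0 \<le> ?M * (?M * (norm x)\<^sup>2 + 2 * (- 1 / ?M) * ?b + (- 1 / ?M)\<^sup>2 * (?M * ?b))"
      using quad M0 by (intro mult_nonneg_nonneg)
    also have "\<dots> = (?M * norm x)\<^sup>2 - ?b"
      using False by (simp add: field_simps power2_eq_square)
    finally show ?thesis by simp
  qed
  then show "norm (f x) \<le> ?M * norm x"
    by (rule power2_le_imp_le) (simp add: M0)
qed

text \<open>The bridge from the sesquilinear form to the real inner product, for which
  \<open>onorm_mono_psd\<close> is stated.\<close>

lemma Re_cdot: "Re (cdot y x) = y \<bullet> x"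
  by (simp add: cdot_def inner_vec_def inner_complex_def)

lemma cdot_hermitian:
  assumes "hermitian A"
  shows "cdot x (A *v y) = cdot (A *v x) y"
proof -
  have A: "cnj (A $ i $ j) = A $ j $ i" for i j
    using assms by (metis (no_types, lifting) hermitian_def conj_transpose_def vec_lambda_beta)
  have "cdot x (A *v y) = (\<Sum>i\<in>UNIV. \<Sum>j\<in>UNIV. cnj (x $ i) * (A $ i $ j * y $ j))"
    by (simp add: cdot_def matrix_vector_mult_def sum_distrib_left)
  also have "\<dots> = (\<Sum>j\<in>UNIV. \<Sum>i\<in>UNIV. cnj (x $ i) * (A $ i $ j * y $ j))"
    by (rule sum.swap)
  also have "\<dots> = cdot (A *v x) y"
    by (simp add: cdot_def matrix_vector_mult_def sum_distrib_left A mult_ac)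
  finally show ?thesis .
qed

text \<open>After taking real parts, a Hermitian positive semi-definite matrix acts as a symmetric
  positive operator on the underlying real inner product space, so \<open>onorm_mono_psd\<close>
  applies.\<close>

lemma op_two_norm_mono:
  assumes "hermitian_psd A" and "hermitian_psd B"
  shows "op_two_norm A \<le> op_two_norm (A + B)"
proof -
  have psd: "0 \<le> x \<bullet> (C *v x)" if "hermitian_psd C" for C and x :: "complex ^ 'a"
    using that unfolding hermitian_psd_def Re_cdot[symmetric]
    by (auto simp: complex_nonneg_Reals_iff)
  have "x \<bullet> (A *v y) = (A *v x) \<bullet> y" for x y
    using assms(1) cdot_hermitian[of A x y] by (simp add: hermitian_psd_def flip: Re_cdot)
  then show ?thesis
    unfolding op_two_norm_def matrix_vector_mult_add_rdistrib
    by (intro onorm_mono_psd matrix_vector_mul_bounded_linear psd assms)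
qed

lemma op_two_norm_pos:
  assumes "A \<noteq> 0"
  shows "0 < op_two_norm A"
  unfolding op_two_norm_def
proof (subst onorm_pos_lt)
  show "\<not> (\<forall>x. A *v x = 0)"
    using assms by (metis matrix_eq matrix_vector_mult_0)
qed (auto intro: matrix_vector_mul_bounded_linear)

text \<open>The norm on nested vectors is the Euclidean norm of the row norms. This gives the
  Frobenius norm its triangle inequality.\<close>

lemma frobenius_norm_eq_norm: "frobenius_norm A = norm A"
  by (simp add: frobenius_norm_def norm_vec_def L2_set_def sum_nonneg)

lemma sqrt_stable_rank:
  assumes "A \<noteq> 0"
  shows "sqrt (stable_rank A) = norm A / op_two_norm A"
  using assms op_two_norm_pos[OF assms]
  by (simp add: stable_rank_def frobenius_norm_eq_norm real_sqrt_divide)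

theorem corollary5p11:
  fixes A B :: "complex ^ 'n ^ 'n"
  assumes "A \<noteq> 0" and "B \<noteq> 0"
    and "hermitian_psd A" and "hermitian_psd B"
  shows "sqrt (stable_rank (A + B)) \<le> sqrt (stable_rank A) + sqrt (stable_rank B)"
proof (cases "A + B = 0")
  case True
  \<comment> \<open>The left side is 0 by the convention for the zero matrix, and the right side is
    nonnegative.\<close>
  then show ?thesis
    using assms(1,2) op_two_norm_pos[of A] op_two_norm_pos[of B]
    by (simp add: stable_rank_def)
next
  case False
  have "norm (A + B) / op_two_norm (A + B)
      \<le> norm A / op_two_norm (A + B) + norm B / op_two_norm (A + B)"
    using op_two_norm_pos[OF False]
    by (simp add: divide_right_mono norm_triangle_ineq flip: add_divide_distrib)
  \<comment> \<open>Each denominator is replaced by a smaller positive one; the bound for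
    \<open>B\<close> is monotonicity with the summands exchanged.\<close>
  also have "\<dots> \<le> norm A / op_two_norm A + norm B / op_two_norm B"
    using op_two_norm_mono[OF assms(3,4)] op_two_norm_mono[OF assms(4,3)]
    by (intro add_mono divide_left_mono mult_pos_pos op_two_norm_pos assms False)
      (auto simp: add.commute)
  finally show ?thesis
    using assms(1,2) False by (simp add: sqrt_stable_rank)
qed

end
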